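(* Let $W$ be a real $k\times n$ matrix of rank $k$ with columns $w^1,\dots,w^n\in\mathbb{R}^k$, let $b\in\mathbb{R}^k$, and suppose the affine subspace $\mathcal{H}=\{x\in\mathbb{R}^n: Wx=b\}$ is generic. Let $\mathcal{P}=[0,1]^n\cap\mathcal{H}$ with vertex set $V$, and for each $v\in V$ let $P_v(x)=|\det W_{S_v}|\prod_{i\in A_v}(1-x_i)\prod_{i\in B_v}x_i\prod_{i\in S_v}x_i(1-x_i)$. Then the Bernoulli race over the Bernstein polynomials $\{P_v\}_{v\in V}$ is a strong Bernoulli factory for $\mathcal{P}$.
   Context: For $S\subseteq[n]$, $W_S$ is the submatrix of $W$ formed by the columns indexed by $S$ (in increasing order of index). $\mathcal{H}$ is called generic if for every $S\subseteq[n]$ with $|S|=k$ and $W_S$ nonsingular, and every $B\subseteq[n]\setminus S$, the vector $W_S^{-1}(b-\sum_{i\in B}w^i)$ has no coordinate in $\{0,1\}$. For a vertex $v$ of $\mathcal{P}$, $A_v=\{i:v_i=0\}$, $B_v=\{i:v_i=1\}$, $S_v=\{i:0<v_i<1\}$ (for generic $\mathcal{H}$, $|S_v|=k$ so $W_{S_v}$ is square). A Bernstein monomial is $\prod_{i=1}^n x_i^{a_i}(1-x_i)^{b_i}$ with nonnegative integers $a_i,b_i$; a Bernstein polynomial is a finite combination $\sum_j c_jM_j(x)$ of Bernstein monomials $M_j$ with positive coefficients $c_j$. A Bernoulli factory with output set $V$ (for inputs $x\in[0,1]^n$) is a (possibly infinite) rooted binary tree whose internal nodes are labeled by an index $i\in[n]$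 or a known constant $c\in(0,1)$ and whose leaves are labeled by elements of $V$; on input $x$ one walks from the root, at a node labeled $i$ flipping a fresh independent coin that is $1$ with probability $x_i$ (an $x_i$-coin), at a node labeled $c$ a fresh coin of bias $c$, following the edge labeled by the outcome, and outputs the label of the leaf reached; $\mathcal{F}(x)$ is the output ($\emptyset$ if no leaf is reached). A strong Bernoulli factory for $\mathcal{P}$ is such a factory with output set $V$ that terminates almost surely (i.e. $\Pr[\mathcal{F}(x)=\emptyset]=0$) and satisfies $\mathbb{E}[\mathcal{F}(x)]=x$ for all $x\in\mathcal{P}$. The Bernoulli race over Bernstein polynomials $\{P_v\}_{v\in V}$ is the following factory: fix a constant $C\ge1$ at least the sum of the coefficients of every $P_v$. In each round, pick $v\in V$ uniformly at random; writing $P_v=\sum_j c_jM_j$, select monomial $M_j$ with probability $c_j/C$ (and with the remaining probability select none, which counts as failure); if $M_j=\prod_i x_i^{a_i}(1-x_i)^{b_i}$ is selected, flip the $x_i$-coin $a_i+b_i$ times for each $i$, and declare success iff for every $i$ the first $a_i$ flips are $1$ and the next $b_i$ flips are $0$. On success output $v$; otherwise start a new round. *)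

theory Defs
  imports "Jordan_Normal_Form.DL_Rank_Submatrix" "Jordan_Normal_Form.Gauss_Jordan_Elimination"
    "HOL-Probability.Stream_Space" "HOL-Probability.Probability_Mass_Function"
begin

definition col_submat :: "real mat \<Rightarrow> nat set \<Rightarrow> real mat" where
  "col_submat W S = submatrix W UNIV S"

definition generic :: "nat \<Rightarrow> nat \<Rightarrow> real mat \<Rightarrow> real Matrix.vec \<Rightarrow> bool" where
  "generic k n W b \<longleftrightarrow>
     (\<forall>S. S \<subseteq> {0..<n} \<and> card S = k \<and> Determinant.det (col_submat W S) \<noteq> 0 \<longrightarrow>
        (\<forall>B. B \<subseteq> {0..<n} - S \<longrightarrow>
           (\<forall>j<k. (the (mat_inverse (col_submat W S)) *\<^sub>v
                      (b - Matrix.vec k (\<lambda>r. \<Sum>i\<in>B. W $$ (r, i)))) $ j \<notin> {0, 1})))"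

definition polytope :: "nat \<Rightarrow> real mat \<Rightarrow> real Matrix.vec \<Rightarrow> real Matrix.vec set" where
  "polytope n W b = {x \<in> carrier_vec n. (\<forall>i<n. 0 \<le> x $ i \<and> x $ i \<le> 1) \<and> W *\<^sub>v x = b}"

definition vertices :: "nat \<Rightarrow> real mat \<Rightarrow> real Matrix.vec \<Rightarrow> real Matrix.vec set" where
  "vertices n W b = {v \<in> polytope n W b.
      \<not> (\<exists>y\<in>polytope n W b. \<exists>z\<in>polytope n W b. y \<noteq> z \<and>
            (\<exists>t::real. 0 < t \<and> t < 1 \<and> v = t \<cdot>\<^sub>v y + (1 - t) \<cdot>\<^sub>v z))}"

definition A_set :: "nat \<Rightarrow> real Matrix.vec \<Rightarrow> nat set" where
  "A_set n v = {i. i < n \<and> v $ i = 0}"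
definition B_set :: "nat \<Rightarrow> real Matrix.vec \<Rightarrow> nat set" where
  "B_set n v = {i. i < n \<and> v $ i = 1}"
definition S_set :: "nat \<Rightarrow> real Matrix.vec \<Rightarrow> nat set" where
  "S_set n v = {i. i < n \<and> 0 < v $ i \<and> v $ i < 1}"

text \<open>A Bernstein polynomial is represented by its list of terms (c_j, a, b), standing for
  c_j * prod_{i<n} x_i^(a i) (1-x_i)^(b i).\<close>
type_synonym bpoly = "(real \<times> (nat \<Rightarrow> nat) \<times> (nat \<Rightarrow> nat)) list"

definition bpoly_coef_sum :: "bpoly \<Rightarrow> real" where
  "bpoly_coef_sum p = (\<Sum>t\<leftarrow>p. fst t)"

definition P_poly :: "real mat \<Rightarrow> nat \<Rightarrow> real Matrix.vec \<Rightarrow> bpoly" where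
  "P_poly W n v =
     [(\<bar>Determinant.det (col_submat W (S_set n v))\<bar>,
       (\<lambda>i. if i \<in> B_set n v \<union> S_set n v then 1 else 0),
       (\<lambda>i. if i \<in> A_set n v \<union> S_set n v then 1 else 0))]"

primrec coins :: "real \<Rightarrow> nat \<Rightarrow> bool list pmf" where
  "coins p 0 = return_pmf []"
| "coins p (Suc m) = bernoulli_pmf p \<bind> (\<lambda>h. coins p m \<bind> (\<lambda>t. return_pmf (h # t)))"

primrec monomial_trial :: "nat list \<Rightarrow> real Matrix.vec \<Rightarrow> (nat \<Rightarrow> nat) \<Rightarrow> (nat \<Rightarrow> nat) \<Rightarrow> bool pmf" where
  "monomial_trial [] x a b = return_pmf True"
| "monomial_trial (i # is) x a b =
     coins (x $ i) (a i + b i) \<bind> (\<lambda>l. monomial_trial is x a b \<bind>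
       (\<lambda>r. return_pmf (l = replicate (a i) True @ replicate (b i) False \<and> r)))"

text \<open>Select term j with probability c_j/C (None = failure with the remaining probability),
  implemented by sequential coins: term j is taken with conditional probability
  c_j / (C - c_1 - ... - c_{j-1}).\<close>
primrec select_term :: "bpoly \<Rightarrow> real \<Rightarrow> ((nat \<Rightarrow> nat) \<times> (nat \<Rightarrow> nat)) option pmf" where
  "select_term [] r = return_pmf None"
| "select_term (t # ts) r =
     bernoulli_pmf (fst t / r) \<bind> (\<lambda>h. if h then return_pmf (Some (snd t)) else select_term ts (r - fst t))"

definition race_round :: "nat \<Rightarrow> real Matrix.vec \<Rightarrow> 'v set \<Rightarrow> ('v \<Rightarrow> bpoly) \<Rightarrow> real \<Rightarrow> 'v option pmf" where
  "race_round n x V P C =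
     pmf_of_set V \<bind> (\<lambda>v. select_term (P v) C \<bind> (\<lambda>m. case m of
        None \<Rightarrow> return_pmf None
      | Some (a, b) \<Rightarrow> monomial_trial [0..<n] x a b \<bind> (\<lambda>s. return_pmf (if s then Some v else None))))"

definition race_space :: "nat \<Rightarrow> real Matrix.vec \<Rightarrow> 'v set \<Rightarrow> ('v \<Rightarrow> bpoly) \<Rightarrow> real \<Rightarrow> 'v option stream measure" where
  "race_space n x V P C = stream_space (measure_pmf (race_round n x V P C))"

definition race_output :: "'v option stream \<Rightarrow> 'v option" where
  "race_output \<omega> = (if \<exists>j. \<omega> !! j \<noteq> None then \<omega> !! (LEAST j. \<omega> !! j \<noteq> None) else None)"

end

theory Submission
  imports Defs
begin

text \<open>
  For a vertex \<open>v\<close> and \<open>i \<notin> S\<^sub>v\<close>, let \<open>T = S\<^sub>v \<union> {i}\<close>. By genericity the coordinates in \<open>T\<close> span an edge of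
  the polytope leaving \<open>v\<close>; let \<open>\<delta>(v,i)\<close> be the kernel vector of \<open>W\<close> supported on \<open>T\<close> that points out of the
  edge at \<open>v\<close> and has \<open>i\<close>-th entry of modulus \<open>|det W\<^bsub>S\<^sub>v\<^esub>|\<close>. Then
  \<open>P\<^sub>v(x) (v - x) = (\<Sum>i\<notin>S\<^sub>v. Q(x) \<delta>(v,i))\<close> for \<open>x\<close> in the polytope, where \<open>Q\<close> is a Bernstein monomial that depends
  on the edge only: both sides lie in the kernel of \<open>W\<close> and agree outside \<open>S\<^sub>v\<close>. By Cramer's rule the
  vectors \<open>\<delta>\<close> at the two ends of an edge are opposite, so everything cancels in
  \<open>\<Sum>v. P\<^sub>v(x) (v - x)\<close>. A vertex on the minimal face of \<open>x\<close> has \<open>P\<^sub>v(x) > 0\<close>, hence a round of the race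
  succeeds with positive probability, and the output is \<open>v\<close> with probability \<open>P\<^sub>v(x) / (\<Sum>u. P\<^sub>u(x))\<close>.
\<close>

section \<open>The Bernoulli race\<close>

lemma pmf_map_Cons:
  "pmf (map_pmf ((#) h) M) (h' # l) = (if h = h' then pmf M l else 0)"
  by (auto simp: pmf_map_inj' inj_def pmf_eq_0_set_pmf)

lemma pmf_coins_replicate:
  assumes "0 \<le> p" "p \<le> 1"
  shows "pmf (coins p (a + b)) (replicate a True @ replicate b False) = p ^ a * (1 - p) ^ b"
proof (induction a)
  case 0
  show ?case
    using assms
    by (induction b) (simp_all add: map_pmf_def[symmetric] pmf_bind pmf_map_Cons)
next
  case (Suc a)
  then show ?case using assms
    by (simp add: map_pmf_def[symmetric] pmf_bind pmf_map_Cons)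
qed

lemma pmf_monomial_trial:
  fixes x :: "real Matrix.vec"
  assumes "distinct is" "\<And>i. i \<in> set is \<Longrightarrow> 0 \<le> x $ i \<and> x $ i \<le> 1"
  shows "pmf (monomial_trial is x a b) True = (\<Prod>i\<in>set is. (x $ i) ^ a i * (1 - x $ i) ^ b i)"
  using assms
proof (induction "is")
  case (Cons i "is")
  let ?w = "replicate (a i) True @ replicate (b i) False"
  let ?f = "\<lambda>l. monomial_trial is x a b \<bind> (\<lambda>r. return_pmf (l = ?w \<and> r))"
  \<comment> \<open>Given the flips \<open>l\<close>, the trial can succeed only if \<open>l\<close>
    is the required word, so the expectation collapses to a single point mass.\<close>
  have f: "pmf (?f l) True = indicator {?w} l * pmf (monomial_trial is x a b) True" for l
    by (cases "l = ?w") (simp_all add: bind_return_pmf')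
  have "pmf (monomial_trial (i # is) x a b) True
      = measure_pmf.expectation (coins (x $ i) (a i + b i)) (\<lambda>l. pmf (?f l) True)"
    by (simp add: pmf_bind)
  also have "\<dots> = pmf (coins (x $ i) (a i + b i)) ?w * pmf (monomial_trial is x a b) True"
    unfolding f by (simp add: measure_pmf_single)
  finally show ?case using Cons by (simp add: pmf_coins_replicate)
qed simp

section \<open>First success in a sequence of independent rounds\<close>

lemma race_output_Stream:
  "race_output (t ## \<omega>) = (case t of None \<Rightarrow> race_output \<omega> | Some v \<Rightarrow> Some v)"
proof (cases t)
  case (Some v)
  then have "(LEAST j. (t ## \<omega>) !! j \<noteq> None) = 0" by (intro Least_equality) auto
  with Some show ?thesis by (auto simp: race_output_def intro!: exI[of _ 0])
next
  case None
  show ?thesis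
  proof (cases "\<exists>j. \<omega> !! j \<noteq> None")
    case True
    then obtain j where j: "\<omega> !! j \<noteq> None" by blast
    have "(LEAST j. (t ## \<omega>) !! j \<noteq> None) = Suc (LEAST j. (t ## \<omega>) !! Suc j \<noteq> None)"
      using j None by (intro Least_Suc[of _ "Suc j"]) auto
    moreover have "\<exists>j. (t ## \<omega>) !! j \<noteq> None" using j by (intro exI[of _ "Suc j"]) auto
    ultimately show ?thesis using None True by (simp add: race_output_def)
  next
    case False
    then have "\<not> (\<exists>j. (t ## \<omega>) !! j \<noteq> None)"
      using None by (metis old.nat.exhaust snth.simps stream.sel)
    with False None show ?thesis by (simp add: race_output_def)
  qed
qed

text \<open>The events are rewritten as countable combinations of conditions on single rounds, which
  removes the \<open>LEAST\<close> from the measurability question.\<close>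

lemma race_output_measurable:
  "{\<omega> \<in> space (stream_space (measure_pmf R)). race_output \<omega> = y} \<in> sets (stream_space (measure_pmf R))"
proof (cases y)
  case None
  have "(race_output \<omega> = y) = (\<forall>j. \<omega> !! j \<in> {None})" for \<omega> :: "'a option stream"
    using LeastI_ex[of "\<lambda>j. \<omega> !! j \<noteq> None"] unfolding race_output_def None by (metis singleton_iff)
  then show ?thesis by simp
next
  case (Some v)
  have "(race_output \<omega> = y) = (\<exists>j. \<omega> !! j \<in> {Some v} \<and> (\<forall>i<j. \<omega> !! i \<in> {None}))" (is "?L = ?R") for \<omega>
  proof
    assume ?L
    with Some show ?R
      by (intro exI[of _ "LEAST j. \<omega> !! j \<noteq> None"])
        (auto simp: race_output_def dest: not_less_Least split: if_splits)
  next
    assume ?R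
    then obtain j where j: "\<omega> !! j = Some v" "\<forall>i<j. \<omega> !! i = None" by auto
    then have "(LEAST j. \<omega> !! j \<noteq> None) = j"
      by (intro Least_equality) (auto simp: not_less[symmetric])
    with j Some show ?L by (auto simp: race_output_def)
  qed
  then show ?thesis by simp
qed

text \<open>Conditioning on the first round gives a linear equation for each output probability.\<close>

lemma measure_race_output:
  fixes R :: "'v option pmf"
  defines "M \<equiv> stream_space (measure_pmf R)"
  defines "q \<equiv> \<lambda>y. measure M {\<omega> \<in> space M. race_output \<omega> = y}"
  assumes "pmf R None < 1"
  shows "q None = 0" and "q (Some v) = pmf R (Some v) / (1 - pmf R None)"
proof -
  interpret prob_space M unfolding M_def by (intro prob_space.prob_space_stream_space prob_space_measure_pmf)
  have sp: "space M = UNIV" by (simp add: M_def space_stream_space)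
  have step: "q y = (case y of None \<Rightarrow> 0 | Some v \<Rightarrow> pmf R (Some v)) + pmf R None * q y" for y
  proof -
    have q: "emeasure M {\<omega>. race_output \<omega> = y} = ennreal (q y)"
      by (simp add: q_def sp emeasure_eq_measure)
    have "ennreal (q y) = (\<integral>\<^sup>+t. emeasure M {\<omega>. race_output (t ## \<omega>) = y} \<partial>measure_pmf R)"
      unfolding q[symmetric] M_def
      using prob_space.emeasure_stream_space[OF prob_space_measure_pmf race_output_measurable[of R y]] sp
      by (simp add: M_def)
    \<comment> \<open>A successful first round fixes the output; after a failed one the remaining
      stream has the original law and contributes \<open>q y\<close> again. For
      \<open>y = None\<close> the first summand is switched off, because a failed round fixes
      nothing.\<close>
    also have "\<dots> = (\<integral>\<^sup>+t. indicator {y} t * of_bool (y \<noteq> None)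
        + indicator {None} t * ennreal (q y) \<partial>measure_pmf R)"
    proof (intro nn_integral_cong)
      fix t
      show "emeasure M {\<omega>. race_output (t ## \<omega>) = y}
          = indicator {y} t * of_bool (y \<noteq> None) + indicator {None} t * ennreal (q y)"
        using q emeasure_space_1[unfolded sp] by (cases t; cases y) (auto simp: race_output_Stream)
    qed
    also have "\<dots> = ennreal (pmf R y) * of_bool (y \<noteq> None) + ennreal (pmf R None) * ennreal (q y)"
      by (simp add: nn_integral_add nn_integral_multc emeasure_pmf_single)
    also have "\<dots> = ennreal ((case y of None \<Rightarrow> 0 | Some v \<Rightarrow> pmf R (Some v)) + pmf R None * q y)"
      by (auto simp: q_def ennreal_mult'' ennreal_plus split: option.splits)
    finally show ?thesis
      by (subst (asm) ennreal_inj) (auto simp: q_def split: option.splits intro!: add_nonneg_nonneg)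
  qed
  from step[of None] assms(3) show "q None = 0" by simp
  from step[of "Some v"] assms(3) show "q (Some v) = pmf R (Some v) / (1 - pmf R None)"
    by (simp add: field_simps)
qed

text \<open>With a single term, sequential selection is one coin of bias \<open>c / C\<close>; the
  bounds on \<open>c\<close> make this a probability. A round that picks another \<open>u\<close>
  never outputs \<open>v\<close>.\<close>

lemma pmf_race_round:
  fixes x :: "real Matrix.vec"
  assumes "finite V" "v \<in> V" "P v = [(c, a, b)]" "0 \<le> c" "c \<le> C" "C \<ge> 1"
    and x: "\<And>i. i < n \<Longrightarrow> 0 \<le> x $ i \<and> x $ i \<le> 1"
  shows "pmf (race_round n x V P C) (Some v)
    = c * (\<Prod>i<n. (x $ i) ^ a i * (1 - x $ i) ^ b i) / (C * real (card V))"
proof -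
  define f where "f u = select_term (P u) C \<bind> (\<lambda>m. case m of
        None \<Rightarrow> return_pmf None
      | Some (a, b) \<Rightarrow> monomial_trial [0..<n] x a b \<bind> (\<lambda>s. return_pmf (if s then Some u else None)))" for u
  have 0: "pmf (f u) (Some v) = 0" if "u \<noteq> v" for u
    using that unfolding f_def pmf_eq_0_set_pmf by (auto split: option.splits if_splits)
  have ite: "pmf (M \<bind> (\<lambda>s. return_pmf (if s then Some v else None))) (Some v) = pmf M True" for M
    using pmf_map_inj'[of "\<lambda>s. if s then Some v else None" M True]
    by (simp add: map_pmf_def inj_def)
  have "pmf (race_round n x V P C) (Some v) = (\<Sum>u\<in>V. pmf (f u) (Some v)) / real (card V)"
    unfolding race_round_def f_def[symmetric] using assms(1,2)
    by (subst pmf_bind, subst integral_pmf_of_set) auto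
  also have "(\<Sum>u\<in>V. pmf (f u) (Some v)) = (\<Sum>u\<in>{v}. pmf (f u) (Some v))"
    using assms(1,2) 0 by (intro sum.mono_neutral_right) auto
  also have "\<dots> = c / C * pmf (monomial_trial [0..<n] x a b) True"
    using assms(3-6)
    by (simp add: f_def pmf_bind[of "bernoulli_pmf _"] bind_assoc_pmf ite bind_return_pmf)
  also have "pmf (monomial_trial [0..<n] x a b) True = (\<Prod>i<n. (x $ i) ^ a i * (1 - x $ i) ^ b i)"
    using x by (subst pmf_monomial_trial) (auto simp: lessThan_atLeast0)
  finally show ?thesis by simp
qed

lemma pmf_race_round_None:
  assumes "finite V" "V \<noteq> {}"
  shows "pmf (race_round n x V P C) None = 1 - (\<Sum>v\<in>V. pmf (race_round n x V P C) (Some v))"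
proof -
  let ?R = "race_round n x V P C"
  have "set_pmf ?R \<subseteq> insert None (Some ` V)"
    using assms by (auto simp: race_round_def split: option.splits if_splits)
  then have "(\<Sum>y\<in>insert None (Some ` V). pmf ?R y) = 1"
    using assms by (intro sum_pmf_eq_1) auto
  then show ?thesis using assms by (simp add: sum.reindex)
qed

section \<open>Nonsingular column selections\<close>

text \<open>Two enumerations of \<open>S\<close> differ by a permutation, which changes the
  determinant by a sign only. Column swaps can therefore ignore the increasing order used in
  \<open>col_submat\<close>.\<close>

lemma abs_det_reindex_cols:
  fixes A :: "nat \<Rightarrow> 'i \<Rightarrow> real"
  assumes f: "bij_betw f {0..<k} S" and g: "bij_betw g {0..<k} S"
  shows "\<bar>Determinant.det (Matrix.mat k k (\<lambda>(r, c). A r (g c)))\<bar> = \<bar>Determinant.det (Matrix.mat k k (\<lambda>(r, c). A r (f c)))\<bar>"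
proof -
  \<comment> \<open>\<open>p\<close> is built to satisfy \<open>f (p c) = g c\<close> for
    \<open>c < k\<close>; it is extended by the identity because \<open>permutes\<close> requires
    that.\<close>
  define p where "p c = (if c \<in> {0..<k} then inv_into {0..<k} f (g c) else c)" for c
  have "bij_betw (inv_into {0..<k} f \<circ> g) {0..<k} {0..<k}"
    using bij_betw_trans[OF g bij_betw_inv_into[OF f]] .
  then have "bij_betw p {0..<k} {0..<k}"
    by (rule bij_betw_cong[THEN iffD1, rotated]) (simp add: p_def)
  then have p: "p permutes {0..<k}"
    by (rule bij_imp_permutes) (auto simp: p_def)
  have fp: "f (p c) = g c" if "c < k" for c
    using that bij_betwE[OF g] bij_betw_imp_surj_on[OF f] by (simp add: p_def f_inv_into_f)
  have pk: "p c < k" if "c < k" for c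
    using permutes_in_image[OF p, of c] that by simp
  let ?B = "Matrix.mat k k (\<lambda>(c, r). A r (f c))"
  have "Determinant.det (Matrix.mat k k (\<lambda>(r, c). A r (g c)))
      = Determinant.det (transpose_mat (Matrix.mat k k (\<lambda>(c, r). ?B $$ (p c, r))))"
    by (intro arg_cong[of _ _ Determinant.det] eq_matI) (auto simp: fp pk)
  also have "\<dots> = signof p * Determinant.det ?B"
    by (subst Determinant.det_transpose[where n = k], simp, subst Determinant.det_permute_rows[OF _ p]) auto
  also have "Determinant.det ?B = Determinant.det (transpose_mat ?B)"
    by (subst Determinant.det_transpose[where n = k]) auto
  also have "transpose_mat ?B = Matrix.mat k k (\<lambda>(r, c). A r (f c))"
    by (intro eq_matI) auto
  finally show ?thesis by (simp add: abs_mult sign_def)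
qed

lemma bij_betw_pick:
  assumes "finite S" "card S = k"
  shows "bij_betw (pick S) {0..<k} S"
proof -
  have "inj_on (pick S) {0..<k}"
    using assms pick_mono[of _ S] by (intro linorder_inj_onI) (auto, fastforce)
  moreover have "pick S ` {0..<k} \<subseteq> S" using assms pick_in_set[of _ S] by auto
  ultimately show ?thesis
    using assms by (metis bij_betw_imageI card_atLeastLessThan card_image card_subset_eq minus_nat.diff_0)
qed

lemma card_swap:
  assumes "finite S" "j \<in> S" "i \<notin> S"
  shows "card (insert i (S - {j})) = card S"
  using assms by (metis Diff_iff card_Suc_Diff1 card_insert_disjoint finite_Diff)

section \<open>Bases and circuits among the columns of \<open>W\<close>\<close>

locale wide_system =
  fixes k n :: nat and W :: "real mat"
  assumes W: "W \<in> carrier_mat k n"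
begin

text \<open>Points are functions of which only the values below \<open>n\<close> matter, so that
  linear combinations need no dimension side conditions.\<close>

definition lin :: "(nat \<Rightarrow> real) \<Rightarrow> real Matrix.vec" where
  "lin d = Matrix.vec k (\<lambda>r. \<Sum>i<n. W $$ (r, i) * d i)"

definition supp_in :: "(nat \<Rightarrow> real) \<Rightarrow> nat set \<Rightarrow> bool" where
  "supp_in d S \<longleftrightarrow> (\<forall>i<n. i \<notin> S \<longrightarrow> d i = 0)"

abbreviation D :: "nat set \<Rightarrow> real" where
  "D S \<equiv> \<bar>Determinant.det (col_submat W S)\<bar>"

definition col_basis :: "nat set \<Rightarrow> bool" where
  "col_basis S \<longleftrightarrow> S \<subseteq> {0..<n} \<and> card S = k \<and> D S \<noteq> 0"

lemma basis_finite: "col_basis S \<Longrightarrow> finite S"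
  by (auto simp: col_basis_def intro: finite_subset)

lemma col_submat_eq:
  assumes "S \<subseteq> {0..<n}" "card S = k"
  shows "col_submat W S = Matrix.mat k k (\<lambda>(r, c). W $$ (r, pick S c))"
proof -
  have "{j. j < n \<and> j \<in> S} = S" using assms by auto
  then show ?thesis using assms W
    by (auto simp: col_submat_def submatrix_def pick_UNIV intro!: cong_mat)
qed

lemma D_eq:
  assumes "S \<subseteq> {0..<n}" "card S = k" "bij_betw f {0..<k} S"
  shows "D S = \<bar>Determinant.det (Matrix.mat k k (\<lambda>(r, c). W $$ (r, f c)))\<bar>"
  using assms by (subst col_submat_eq) (auto intro!: abs_det_reindex_cols bij_betw_pick finite_subset)

lemma col_submat_carrier: "col_basis S \<Longrightarrow> col_submat W S \<in> carrier_mat k k"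
  by (simp add: col_basis_def col_submat_eq)

lemma bij_pick: "col_basis S \<Longrightarrow> bij_betw (pick S) {0..<k} S"
  by (simp add: col_basis_def basis_finite bij_betw_pick)

lemma lin_split:
  assumes "col_basis S"
  shows "lin d = col_submat W S *\<^sub>v Matrix.vec k (\<lambda>c. d (pick S c))
    + Matrix.vec k (\<lambda>r. \<Sum>i\<in>{0..<n} - S. W $$ (r, i) * d i)"
proof (rule eq_vecI)
  fix r assume "r < dim_vec (col_submat W S *\<^sub>v Matrix.vec k (\<lambda>c. d (pick S c))
    + Matrix.vec k (\<lambda>r. \<Sum>i\<in>{0..<n} - S. W $$ (r, i) * d i))"
  then have r: "r < k" by simp
  have S: "S \<subseteq> {0..<n}" "card S = k" using assms by (auto simp: col_basis_def)
  have "(\<Sum>i<n. W $$ (r, i) * d i)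
      = (\<Sum>i\<in>S. W $$ (r, i) * d i) + (\<Sum>i\<in>{0..<n} - S. W $$ (r, i) * d i)"
    unfolding lessThan_atLeast0 using S(1) by (subst sum.subset_diff[of S]) (auto simp: add.commute)
  also have "(\<Sum>i\<in>S. W $$ (r, i) * d i) = (\<Sum>c\<in>{0..<k}. W $$ (r, pick S c) * d (pick S c))"
    by (rule sum.reindex_bij_betw[OF bij_pick[OF assms], symmetric])
  finally show "lin d $ r = (col_submat W S *\<^sub>v Matrix.vec k (\<lambda>c. d (pick S c))
    + Matrix.vec k (\<lambda>r. \<Sum>i\<in>{0..<n} - S. W $$ (r, i) * d i)) $ r"
    using r S by (simp add: lin_def col_submat_eq scalar_prod_def)
qed (simp add: lin_def col_submat_eq assms[unfolded col_basis_def])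

lemma basis_inverse:
  assumes "col_basis S"
  obtains M where "mat_inverse (col_submat W S) = Some M" "M \<in> carrier_mat k k"
    "col_submat W S * M = 1\<^sub>m k" "M * col_submat W S = 1\<^sub>m k"
proof -
  have A: "col_submat W S \<in> carrier_mat k k" by (rule col_submat_carrier[OF assms])
  moreover have "Determinant.det (col_submat W S) \<noteq> 0" using assms by (simp add: col_basis_def)
  ultimately obtain M where "mat_inverse (col_submat W S) = Some M"
    using mat_inverse(1)[OF A, where b = "()"] det_non_zero_imp_unit[OF A, where b = "()"] by (cases "mat_inverse (col_submat W S)") auto
  with mat_inverse(2)[OF A this] that show thesis by auto
qed

text \<open>On \<open>S\<close> the equation is \<open>W_S d_S = 0\<close> with \<open>W_S\<close>
  invertible.\<close>

lemma ker_basis_zero: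
  assumes S: "col_basis S" and d: "lin d = 0\<^sub>v k" "supp_in d S" and i: "i < n"
  shows "d i = 0"
proof (cases "i \<in> S")
  case True
  let ?A = "col_submat W S" and ?v = "Matrix.vec k (\<lambda>c. d (pick S c))"
  obtain M where M: "M \<in> carrier_mat k k" "M * ?A = 1\<^sub>m k" by (rule basis_inverse[OF S])
  have A: "?A \<in> carrier_mat k k" by (rule col_submat_carrier[OF S])
  have "(\<Sum>i\<in>{0..<n} - S. W $$ (r, i) * d i) = 0" for r
    using d(2) by (intro sum.neutral) (auto simp: supp_in_def)
  then have "Matrix.vec k (\<lambda>r. \<Sum>i\<in>{0..<n} - S. W $$ (r, i) * d i) = 0\<^sub>v k"
    by (intro eq_vecI) auto
  then have "?A *\<^sub>v ?v = 0\<^sub>v k"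
    using lin_split[OF S, of d] d(1) A by (simp add: right_zero_vec[of _ k])
  then have "(M * ?A) *\<^sub>v ?v = 0\<^sub>v k"
    using M A by (subst assoc_mult_mat_vec[of _ k k]) auto
  then have v: "?v = 0\<^sub>v k" using M by simp
  obtain c where "c < k" "pick S c = i"
    using bij_betw_imp_surj_on[OF bij_pick[OF S]] True by (metis atLeastLessThan_iff imageE)
  with v show ?thesis by (metis index_vec index_zero_vec(1))
qed (use d i in \<open>auto simp: supp_in_def\<close>)

text \<open>The entry at \<open>i\<close> is free; the entries on \<open>S\<close> then solve
  \<open>W_S y = - t w^i\<close>.\<close>

lemma circuit_exists:
  assumes S: "col_basis S" and i: "i < n" "i \<notin> S"
  obtains d where "lin d = 0\<^sub>v k" "supp_in d (insert i S)" "d i = t"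
proof -
  let ?A = "col_submat W S"
  let ?w = "Matrix.vec k (\<lambda>r. W $$ (r, i) * t)"
  obtain M where M: "M \<in> carrier_mat k k" "?A * M = 1\<^sub>m k" by (rule basis_inverse[OF S])
  have A: "?A \<in> carrier_mat k k" by (rule col_submat_carrier[OF S])
  define y where "y = M *\<^sub>v (- ?w)"
  have y: "y \<in> carrier_vec k" using M by (simp add: y_def)
  have Ay: "?A *\<^sub>v y = - ?w" unfolding y_def
    using assoc_mult_mat_vec[OF A M(1), of "- ?w"] M by simp
  define d where "d j = (if j = i then t else if j \<in> S then y $ (inv_into {0..<k} (pick S) j) else 0)" for j
  have pk: "d (pick S c) = y $ c" if "c < k" for c
  proof -
    have "pick S c \<in> S" "inv_into {0..<k} (pick S) (pick S c) = c"
      using bij_pick[OF S] that by (auto simp: bij_betw_def)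
    with i show ?thesis by (auto simp: d_def)
  qed
  have "Matrix.vec k (\<lambda>c. d (pick S c)) = y" using y pk by (intro eq_vecI) auto
  moreover have "(\<Sum>j\<in>{0..<n} - S. W $$ (r, j) * d j) = (\<Sum>j\<in>{i}. W $$ (r, j) * d j)" for r
    using i by (intro sum.mono_neutral_right) (auto simp: d_def)
  then have "Matrix.vec k (\<lambda>r. \<Sum>j\<in>{0..<n} - S. W $$ (r, j) * d j) = ?w" by (simp add: d_def)
  ultimately have "lin d = 0\<^sub>v k" using lin_split[OF S, of d] Ay by simp
  moreover have "supp_in d (insert i S)" "d i = t" by (auto simp: supp_in_def d_def)
  ultimately show thesis by (rule that)
qed

text \<open>Cramer's rule for \<open>W_S d_S = - d_i w^i\<close>. The numerator matrix carries
  \<open>w^i\<close> in place of column \<open>j\<close>, so it lists the columns of the swapped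
  set; absolute values absorb the change of order.\<close>

lemma circuit_cramer:
  assumes S: "col_basis S" and i: "i < n" "i \<notin> S" and d: "lin d = 0\<^sub>v k" "supp_in d (insert i S)"
    and j: "j \<in> S"
  shows "\<bar>d j\<bar> * D S = \<bar>d i\<bar> * D (insert i (S - {j}))"
proof -
  let ?A = "col_submat W S" and ?v = "Matrix.vec k (\<lambda>c. d (pick S c))"
  have A: "?A \<in> carrier_mat k k" by (rule col_submat_carrier[OF S])
  have Sn: "S \<subseteq> {0..<n}" "card S = k" using S by (auto simp: col_basis_def)
  obtain q where q: "q < k" "pick S q = j"
    using bij_betw_imp_surj_on[OF bij_pick[OF S]] j by (metis atLeastLessThan_iff imageE)
  have "(\<Sum>j\<in>{0..<n} - S. W $$ (r, j) * d j) = (\<Sum>j\<in>{i}. W $$ (r, j) * d j)" for r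
    using i d(2) by (intro sum.mono_neutral_right) (auto simp: supp_in_def)
  then have "?A *\<^sub>v ?v + Matrix.vec k (\<lambda>r. W $$ (r, i) * d i) = 0\<^sub>v k"
    using lin_split[OF S, of d] d(1) by simp
  then have "(?A *\<^sub>v ?v) $ r + W $$ (r, i) * d i = 0" if "r < k" for r
    using that A by (metis carrier_matD(1) dim_mult_mat_vec dim_vec index_add_vec(1) index_vec index_zero_vec(1))
  then have Av: "(?A *\<^sub>v ?v) $ r = - d i * W $$ (r, i)" if "r < k" for r
    using that by (simp add: eq_neg_iff_add_eq_0 mult.commute)
  \<comment> \<open>\<open>f\<close> enumerates the swapped set with \<open>i\<close> in the
    position of \<open>j\<close>, in general not increasingly; \<open>D_eq\<close> allows
    this.\<close>
  define f where "f = (pick S)(q := i)"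
  define S' where "S' = insert i (S - {j})"
  let ?B = "Matrix.mat k k (\<lambda>(r, c). W $$ (r, f c))"
  have S': "S' \<subseteq> {0..<n}" "card S' = k"
    using i Sn(1) card_swap[OF basis_finite[OF S] j i(2)] unfolding S'_def Sn(2) by auto
  have pick: "inj_on (pick S) {0..<k}" "pick S ` {0..<k} = S"
    using bij_pick[OF S] by (auto simp: bij_betw_def)
  have "inj_on f {0..<k}"
    using pick i unfolding f_def by (intro inj_on_fun_updI) auto
  moreover have "f ` {0..<k} = insert i (pick S ` ({0..<k} - {q}))"
    using q(1) by (auto simp: f_def)
  then have "f ` {0..<k} = S'"
    using q pick(2) inj_on_image_set_diff[OF pick(1), of "{0..<k}" "{q}"] by (simp add: S'_def)
  ultimately have f: "bij_betw f {0..<k} S'" by (simp add: bij_betw_def)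
  have "d j * Determinant.det ?A = Determinant.det (replace_col ?A (?A *\<^sub>v ?v) q)"
    using cramer_lemma_mat[OF A _ q(1), of ?v] q by simp
  \<comment> \<open>The scalar \<open>- d i\<close> is pulled out of column \<open>q\<close> as a
    row of the transpose, where \<open>multrow\<close> applies.\<close>
  also have "replace_col ?A (?A *\<^sub>v ?v) q = transpose_mat (multrow q (- d i) (transpose_mat ?B))"
    using A q Av Sn by (intro eq_matI) (auto simp: replace_col_def f_def col_submat_eq)
  also have "Determinant.det \<dots> = - d i * Determinant.det ?B"
    using q by (subst Determinant.det_transpose[where n = k], simp, subst det_multrow[of _ k]) (auto simp: Determinant.det_transpose[where n = k])
  finally have "\<bar>d j * Determinant.det ?A\<bar> = \<bar>- d i * Determinant.det ?B\<bar>" by simp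
  then show ?thesis using D_eq[OF S' f] by (simp add: abs_mult S'_def)
qed

text \<open>The left side of \<open>circuit_cramer\<close> is nonzero, hence so is \<open>D\<close>
  of the swapped set.\<close>

lemma basis_exchange:
  assumes S: "col_basis S" and i: "i < n" "i \<notin> S" and d: "lin d = 0\<^sub>v k" "supp_in d (insert i S)" "d i \<noteq> 0"
    and j: "j \<in> S" "d j \<noteq> 0"
  shows "col_basis (insert i (S - {j}))"
proof -
  have "card (insert i (S - {j})) = k"
    using card_swap[OF basis_finite[OF S] j(1) i(2)] S by (simp only: col_basis_def)
  moreover have "D (insert i (S - {j})) \<noteq> 0"
    using circuit_cramer[OF S i d(1,2) j(1)] S d(3) j(2) unfolding col_basis_def by (metis abs_eq_0 mult_eq_0_iff)
  moreover have "insert i (S - {j}) \<subseteq> {0..<n}" using S i unfolding col_basis_def by auto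
  ultimately show ?thesis unfolding col_basis_def by blast
qed

lemma basis_extend:
  assumes S0: "col_basis S0" and I: "I \<subseteq> {0..<n}"
    and ind: "\<And>d. lin d = 0\<^sub>v k \<Longrightarrow> supp_in d I \<Longrightarrow> \<forall>i<n. d i = 0"
  obtains S where "col_basis S" "I \<subseteq> S"
proof - \<comment> \<open>A basis that misses as little of \<open>I\<close> as possible contains \<open>I\<close>, by exchange along a circuit.\<close>
  have finI: "finite I" using I finite_subset by blast
  define m where "m S = card (I - S)" for S
  define S where "S = arg_min m col_basis"
  have S: "col_basis S" and min: "\<And>S'. col_basis S' \<Longrightarrow> m S \<le> m S'"
    using arg_min_nat_lemma[of col_basis S0 m] S0 by (auto simp: S_def)
  have "I \<subseteq> S"
  proof (rule ccontr)
    assume "\<not> I \<subseteq> S"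
    then obtain i where i: "i \<in> I" "i \<notin> S" by blast
    then have "i < n" using I by auto
    obtain d where d: "lin d = 0\<^sub>v k" "supp_in d (insert i S)" "d i = 1"
      using circuit_exists[OF S \<open>i < n\<close> i(2)] .
    \<comment> \<open>A kernel vector with \<open>d i = 1\<close> cannot be supported on the
      independent set \<open>I\<close>, so it has a nonzero entry at some \<open>j\<close> in
      \<open>S\<close> outside \<open>I\<close>; trading \<open>j\<close> for \<open>i\<close> loses
      nothing of \<open>I\<close>.\<close>
    have "\<not> supp_in d I" using ind[OF d(1)] d(3) \<open>i < n\<close> by force
    then obtain j where j: "j < n" "j \<notin> I" "d j \<noteq> 0" by (auto simp: supp_in_def)
    with d(2) i have jS: "j \<in> S" by (auto simp: supp_in_def)
    have "col_basis (insert i (S - {j}))"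
      using basis_exchange[OF S \<open>i < n\<close> i(2) d(1,2)] d(3) jS j by simp
    from min[OF this] have "card (I - S) \<le> card (I - insert i (S - {j}))" by (simp add: m_def)
    also have "I - insert i (S - {j}) = (I - S) - {i}" using j by auto
    also have "card \<dots> < card (I - S)" using i finI by (intro card_Diff1_less) auto
    finally show False by simp
  qed
  with S show thesis by (rule that)
qed

text \<open>A maximal independent set of columns has as many elements as the rank, here
  \<open>k\<close>, and these columns form a square matrix of full rank.\<close>

lemma basis_exists:
  assumes "vec_space.rank k W = k"
  obtains S where "col_basis S"
proof -
  interpret vec_space "TYPE(real)" k by unfold_locales
  obtain U where U: "maximal U (\<lambda>T. T \<subseteq> set (cols W) \<and> lin_indpt T)"
    using maximal_exists[of "(\<lambda>T. T \<subseteq> set (cols W) \<and> lin_indpt T)" "card (set (cols W))" "{}"]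
    by (meson List.finite_set card_mono empty_iff empty_subsetI finite_lin_indpt2 rev_finite_subset)
  then have Uc: "U \<subseteq> set (cols W)" "lin_indpt U" by (auto simp: maximal_def)
  have cardU: "card U = k" using rank_card_indpt[OF W U] assms by simp
  have "U \<subseteq> col W ` {0..<n}" using Uc(1) W by (auto simp: cols_def)
  \<comment> \<open>Columns may repeat in \<open>W\<close>, so one index is chosen for each member
    of \<open>U\<close>.\<close>
  then obtain S where S: "S \<subseteq> {0..<n}" "inj_on (col W) S" "U = col W ` S"
    by (meson subset_image_inj)
  then have cS: "card S = k" using cardU by (simp add: card_image)
  have bij: "bij_betw (pick S) {0..<k} S"
    using S(1) cS by (intro bij_betw_pick) (auto intro: finite_subset)
  have A: "col_submat W S \<in> carrier_mat k k" by (simp add: col_submat_eq[OF S(1) cS])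
  have "cols (col_submat W S) = map (\<lambda>c. col W (pick S c)) [0..<k]"
  proof -
    have "col (col_submat W S) c = col W (pick S c)" if "c < k" for c
    proof -
      have "pick S c < n" using bij_betwE[OF bij] that S(1) by force
      with that W show ?thesis by (intro eq_vecI) (auto simp: col_submat_eq[OF S(1) cS])
    qed
    then show ?thesis using A by (auto simp: cols_def)
  qed
  moreover have "distinct (map (\<lambda>c. col W (pick S c)) [0..<k])"
    using comp_inj_on[of "pick S" "{0..<k}" "col W"] bij S(2)
    by (simp add: distinct_map bij_betw_def comp_def)
  moreover have "set (map (\<lambda>c. col W (pick S c)) [0..<k]) = U"
    using bij_betw_imp_surj_on[OF bij] S(3) by (metis image_image list.set_map set_upt)
  ultimately have "rank (col_submat W S) = k"
    using lin_indpt_full_rank[OF A] Uc(2) by simp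
  then have "col_basis S" using det_rank_iff[OF A] S(1) cS by (simp add: col_basis_def)
  then show thesis by (rule that)
qed

end

section \<open>Vertices of a generic section of the cube\<close>

text \<open>The ray is followed up to the first time at which a moving coordinate reaches the facet
  it heads for. The admissibility hypotheses say that none of them is there at the start, so this
  time is positive.\<close>

lemma ray_exits_cube:
  fixes z d :: "nat \<Rightarrow> real"
  assumes cube: "\<And>i. i < n \<Longrightarrow> 0 \<le> z i \<and> z i \<le> 1"
    and adm: "\<And>i. i < n \<Longrightarrow> d i > 0 \<Longrightarrow> z i < 1" "\<And>i. i < n \<Longrightarrow> d i < 0 \<Longrightarrow> z i > 0"
    and nz: "\<exists>i<n. d i \<noteq> 0"
  obtains t i where "t > 0" "i < n" "d i \<noteq> 0" "z i + t * d i \<in> {0, 1}"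
    "\<And>m. m < n \<Longrightarrow> 0 \<le> z m + t * d m \<and> z m + t * d m \<le> 1"
proof -
  define J where "J = {i. i < n \<and> d i \<noteq> 0}"
  \<comment> \<open>\<open>\<tau> i\<close> is the time at which coordinate \<open>i\<close> reaches
    1 if it increases and 0 if it decreases.\<close>
  define \<tau> where "\<tau> i = ((if d i > 0 then 1 else 0) - z i) / d i" for i
  have J: "finite J" "J \<noteq> {}" using nz by (auto simp: J_def)
  have pos: "\<tau> i > 0" if "i \<in> J" for i
    using that adm[of i] by (auto simp: J_def \<tau>_def zero_less_divide_iff)
  define t where "t = Min (\<tau> ` J)"
  have "t \<in> \<tau> ` J" unfolding t_def using J by (intro Min_in) auto
  then obtain i where i: "i \<in> J" "t = \<tau> i" by blast
  have le: "t \<le> \<tau> m" if "m \<in> J" for m unfolding t_def using J that by auto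
  show thesis
  proof (rule that)
    show "t > 0" using i pos by simp
    show "i < n" "d i \<noteq> 0" using i by (auto simp: J_def)
    show "z i + t * d i \<in> {0, 1}" using i by (auto simp: J_def \<tau>_def)
    fix m assume m: "m < n"
    show "0 \<le> z m + t * d m \<and> z m + t * d m \<le> 1"
    proof (cases "d m" "0::real" rule: linorder_cases)
      case less
      then have "t \<le> z m / - d m" using le[of m] m by (simp add: J_def \<tau>_def)
      then have "t * - d m \<le> z m" using less by (subst (asm) pos_le_divide_eq) auto
      moreover have "t * d m \<le> 0" using less \<open>t > 0\<close> by (simp add: mult_le_0_iff)
      ultimately show ?thesis using cube[OF m] by auto
    next
      case greater
      then have "t \<le> (1 - z m) / d m" using le[of m] m by (simp add: J_def \<tau>_def)
      then have "t * d m \<le> 1 - z m" using greater by (subst (asm) pos_le_divide_eq) auto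
      moreover have "t * d m \<ge> 0" using greater \<open>t > 0\<close> by simp
      ultimately show ?thesis using cube[OF m] by auto
    qed (use cube[OF m] in auto)
  qed
qed

corollary ray_exits_cube_interior:
  fixes z d :: "nat \<Rightarrow> real"
  assumes cube: "\<And>i. i < n \<Longrightarrow> 0 \<le> z i \<and> z i \<le> 1"
    and int: "\<And>i. i < n \<Longrightarrow> d i \<noteq> 0 \<Longrightarrow> 0 < z i \<and> z i < 1"
    and nz: "i < n" "d i \<noteq> 0"
  shows "\<exists>t j. t > 0 \<and> j < n \<and> d j \<noteq> 0 \<and> z j + t * d j \<in> {0, 1}
    \<and> (\<forall>m<n. 0 \<le> z m + t * d m \<and> z m + t * d m \<le> 1)"
proof (rule ray_exits_cube[of n z d])
  show "\<exists>i<n. d i \<noteq> 0" using nz by blast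
  show "z i < 1" if "i < n" "d i > 0" for i using int[of i] that by simp
  show "z i > 0" if "i < n" "d i < 0" for i using int[of i] that by simp
qed (use cube in blast)+

section \<open>The kernel of \<open>W\<close> as a linear space\<close>

context wide_system
begin

lemma lin_eq_iff:
  "lin y = lin z \<longleftrightarrow> (\<forall>r<k. (\<Sum>i<n. W $$ (r, i) * y i) = (\<Sum>i<n. W $$ (r, i) * z i))"
proof
  assume eq: "lin y = lin z"
  show "\<forall>r<k. (\<Sum>i<n. W $$ (r, i) * y i) = (\<Sum>i<n. W $$ (r, i) * z i)"
  proof (intro allI impI)
    fix r assume "r < k"
    with arg_cong[OF eq, of "\<lambda>u. vec_index u r"]
    show "(\<Sum>i<n. W $$ (r, i) * y i) = (\<Sum>i<n. W $$ (r, i) * z i)" by (simp add: lin_def)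
  qed
qed (auto simp: lin_def)

lemma lin_zero_iff: "lin d = 0\<^sub>v k \<longleftrightarrow> (\<forall>r<k. (\<Sum>i<n. W $$ (r, i) * d i) = 0)"
proof -
  have "0\<^sub>v k = lin (\<lambda>_. 0)" by (intro eq_vecI) (auto simp: lin_def)
  then show ?thesis by (simp add: lin_eq_iff)
qed

lemma lin_cong: "(\<And>i. i < n \<Longrightarrow> y i = z i) \<Longrightarrow> lin y = lin z"
  by (simp add: lin_eq_iff)

lemma lin_diff: "lin y = lin z \<Longrightarrow> lin (\<lambda>i. y i - z i) = 0\<^sub>v k"
  by (simp add: lin_eq_iff lin_zero_iff right_diff_distrib sum_subtractf)

lemma ker_scale: "lin d = 0\<^sub>v k \<Longrightarrow> lin (\<lambda>i. t * d i) = 0\<^sub>v k"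
  by (simp add: lin_zero_iff mult.left_commute[of _ t] sum_distrib_left[symmetric])

lemma lin_add_ker: "lin d = 0\<^sub>v k \<Longrightarrow> lin (\<lambda>i. z i + t * d i) = lin z"
  using ker_scale[of d t] by (simp add: lin_zero_iff lin_eq_iff distrib_left sum.distrib)

lemma ker_diff: "lin d = 0\<^sub>v k \<Longrightarrow> lin e = 0\<^sub>v k \<Longrightarrow> lin (\<lambda>i. d i - e i) = 0\<^sub>v k"
  by (rule lin_diff) simp

lemma ker_sum:
  assumes "\<And>e. e \<in> I \<Longrightarrow> lin (f e) = 0\<^sub>v k"
  shows "lin (\<lambda>i. \<Sum>e\<in>I. f e i) = 0\<^sub>v k"
proof -
  have "(\<Sum>i<n. W $$ (r, i) * (\<Sum>e\<in>I. f e i)) = (\<Sum>e\<in>I. \<Sum>i<n. W $$ (r, i) * f e i)" for r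
    by (simp add: sum_distrib_left) (rule sum.swap)
  then show ?thesis using assms by (auto simp: lin_zero_iff)
qed

end

section \<open>Vertices and column bases\<close>

locale generic_section = wide_system +
  fixes b :: "real Matrix.vec"
  assumes full_rank: "vec_space.rank k W = k" and b: "b \<in> carrier_vec k" and gen: "generic k n W b"
begin

abbreviation P :: "real Matrix.vec set" where "P \<equiv> polytope n W b"
abbreviation V :: "real Matrix.vec set" where "V \<equiv> vertices n W b"
abbreviation S :: "real Matrix.vec \<Rightarrow> nat set" where "S \<equiv> S_set n"

lemma lin_vec_index: "v \<in> carrier_vec n \<Longrightarrow> lin (vec_index v) = W *\<^sub>v v"
  using W by (intro eq_vecI) (auto simp: lin_def scalar_prod_def lessThan_atLeast0)

lemma in_P_iff: "v \<in> P \<longleftrightarrow> v \<in> carrier_vec n \<and> (\<forall>i<n. 0 \<le> vec_index v i \<and> vec_index v i \<le> 1) \<and> lin (vec_index v) = b"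
  by (auto simp: polytope_def lin_vec_index)

lemma P_carrier: "v \<in> P \<Longrightarrow> v \<in> carrier_vec n"
  by (simp add: in_P_iff)

lemma vec_in_P:
  assumes "\<And>i. i < n \<Longrightarrow> 0 \<le> z i \<and> z i \<le> 1" "lin z = b"
  shows "Matrix.vec n z \<in> P"
  using assms lin_cong[of "vec_index (Matrix.vec n z)" z] by (simp add: in_P_iff)

lemma V_subset_P: "V \<subseteq> P"
  by (auto simp: vertices_def)

lemma S_subset: "S v \<subseteq> {0..<n}"
  by (auto simp: S_set_def)

lemma not_in_S: "v \<in> P \<Longrightarrow> i < n \<Longrightarrow> i \<notin> S v \<longleftrightarrow> vec_index v i \<in> {0, 1}"
  by (force simp: in_P_iff S_set_def)

lemma P_eqI: "v \<in> P \<Longrightarrow> w \<in> P \<Longrightarrow> (\<And>i. i < n \<Longrightarrow> vec_index v i = vec_index w i) \<Longrightarrow> v = w"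
  by (auto simp: in_P_iff)

lemma vertex_not_between:
  assumes "u \<in> V" "v \<in> P" "w \<in> P" "v \<noteq> w" "0 < t" "t < 1"
    "\<And>i. i < n \<Longrightarrow> vec_index u i = t * vec_index v i + (1 - t) * vec_index w i"
  shows False
proof -
  have "u \<in> carrier_vec n" "v \<in> carrier_vec n" "w \<in> carrier_vec n"
    using assms(1-3) V_subset_P P_carrier by blast+
  then have "u = t \<cdot>\<^sub>v v + (1 - t) \<cdot>\<^sub>v w"
    using assms(7) by (intro eq_vecI) auto
  with assms show False by (auto simp: vertices_def)
qed

text \<open>A nonzero kernel vector supported on the fractional coordinates could be followed both
  forwards and backwards inside the polytope, and \<open>v\<close> would lie strictly between the
  two points reached.\<close>

lemma vertex_independent:
  assumes v: "v \<in> V" and d: "lin d = 0\<^sub>v k" "supp_in d (S v)" and i: "i < n"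
  shows "d i = 0"
proof (rule ccontr)
  assume nz: "d i \<noteq> 0"
  have vP: "v \<in> P" using v V_subset_P by auto
  have move: "\<exists>t>0. Matrix.vec n (\<lambda>m. vec_index v m + t * e m) \<in> P"
    if e: "lin e = 0\<^sub>v k" "supp_in e (S v)" "e i \<noteq> 0" for e
  proof -
    have "0 < vec_index v m \<and> vec_index v m < 1" if "m < n" "e m \<noteq> 0" for m
      using that e(2) by (auto simp: supp_in_def S_set_def)
    then obtain t where "t > 0" "\<And>m. m < n \<Longrightarrow> 0 \<le> vec_index v m + t * e m \<and> vec_index v m + t * e m \<le> 1"
      using ray_exits_cube_interior[of n "vec_index v" e i] vP i e(3) unfolding in_P_iff by blast
    then have "Matrix.vec n (\<lambda>m. vec_index v m + t * e m) \<in> P"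
      using vP e(1) by (intro vec_in_P) (auto simp: in_P_iff lin_add_ker)
    with \<open>t > 0\<close> show ?thesis by blast
  qed
  obtain t where t: "t > 0" "Matrix.vec n (\<lambda>m. vec_index v m + t * d m) \<in> P"
    using move[OF d nz] by blast
  obtain s where s: "s > 0" "Matrix.vec n (\<lambda>m. vec_index v m + s * (- 1 * d m)) \<in> P"
    using move[of "\<lambda>m. - 1 * d m"] ker_scale[OF d(1), of "-1"] d(2) nz by (auto simp: supp_in_def)
  show False
  proof (rule vertex_not_between[OF v t(2) s(2)])
    show "Matrix.vec n (\<lambda>m. vec_index v m + t * d m) \<noteq> Matrix.vec n (\<lambda>m. vec_index v m + s * (- 1 * d m))"
    proof
      assume "Matrix.vec n (\<lambda>m. vec_index v m + t * d m) = Matrix.vec n (\<lambda>m. vec_index v m + s * (- 1 * d m))"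
      from arg_cong[OF this, of "\<lambda>u. vec_index u i"] have "(t + s) * d i = 0"
        using i by (simp add: algebra_simps)
      then show False using nz t s by simp
    qed
    show "0 < s / (t + s)" "s / (t + s) < 1" using t s by auto
    fix m assume m: "m < n"
    \<comment> \<open>The weights \<open>l\<close> and \<open>1 - l\<close> are those for which the
      displacements \<open>t d\<close> and \<open>- s d\<close> cancel.\<close>
    define l where "l = s / (t + s)"
    have "l * t = (1 - l) * s" using t(1) s(1) by (simp add: l_def field_simps)
    moreover have "l * (c + t * e) + (1 - l) * (c + s * (- 1 * e)) = c + (l * t - (1 - l) * s) * e" for c e
      by (simp add: algebra_simps)
    ultimately show "vec_index v m = s / (t + s) * vec_index (Matrix.vec n (\<lambda>m. vec_index v m + t * d m)) m +
         (1 - s / (t + s)) * vec_index (Matrix.vec n (\<lambda>m. vec_index v m + s * (- 1 * d m))) m"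
      unfolding l_def[symmetric] using m by simp
  qed
qed

text \<open>Since 0 and 1 are extreme in the unit interval, the ends of a segment through
  \<open>v\<close> agree with \<open>v\<close> outside \<open>S v\<close>; their difference is then
  a kernel vector supported on \<open>S v\<close>.\<close>

lemma vertexI:
  assumes v: "v \<in> P" and ind: "\<And>d i. lin d = 0\<^sub>v k \<Longrightarrow> supp_in d (S v) \<Longrightarrow> i < n \<Longrightarrow> d i = 0"
  shows "v \<in> V"
proof -
  have "y = z" if yz: "y \<in> P" "z \<in> P" "0 < t" "t < 1" "v = t \<cdot>\<^sub>v y + (1 - t) \<cdot>\<^sub>v z" for y z t
  proof -
    let ?d = "\<lambda>i. vec_index y i - vec_index z i"
    have "vec_index y i = vec_index z i" if i: "i < n" "i \<notin> S v" for i
    proof -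
      have vi: "vec_index v i = t * vec_index y i + (1 - t) * vec_index z i"
        using yz i by (auto simp: in_P_iff)
      have yi: "0 \<le> vec_index y i" "vec_index y i \<le> 1" "0 \<le> vec_index z i" "vec_index z i \<le> 1"
        using yz i by (auto simp: in_P_iff)
      have nn: "0 \<le> t * vec_index y i" "0 \<le> (1 - t) * vec_index z i"
        "t * vec_index y i \<le> t" "(1 - t) * vec_index z i \<le> 1 - t"
        using yi yz(3,4) by (auto simp: mult_le_cancel_left1)
      consider "vec_index v i = 0" | "vec_index v i = 1" using not_in_S[OF v i(1)] i(2) by auto
      then show ?thesis
      proof cases
        case 1
        then have "t * vec_index y i = 0" "(1 - t) * vec_index z i = 0" using vi nn by linarith+
        with yz show ?thesis by simp
      next
        case 2
        then have "t * vec_index y i = t" "(1 - t) * vec_index z i = 1 - t" using vi nn by linarith+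
        with yz show ?thesis by simp
      qed
    qed
    then have "supp_in ?d (S v)" by (auto simp: supp_in_def)
    moreover have "lin ?d = 0\<^sub>v k" using yz by (intro lin_diff) (auto simp: in_P_iff)
    ultimately have "?d i = 0" if "i < n" for i using ind[of ?d] that by blast
    then show "y = z" using yz by (intro P_eqI) auto
  qed
  with v show ?thesis by (auto simp: vertices_def)
qed

text \<open>This is where genericity enters: the coordinates on \<open>T\<close> are the vector in
  \<open>generic\<close>, with \<open>B\<close> the indices outside \<open>T\<close> at which
  \<open>z\<close> equals 1.\<close>

lemma generic_coordinates:
  assumes T: "col_basis T" and z: "lin z = b" "\<And>i. i < n \<Longrightarrow> i \<notin> T \<Longrightarrow> z i \<in> {0, 1}" and j: "j \<in> T"
  shows "z j \<notin> {0, 1}"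
proof -
  let ?A = "col_submat W T" and ?v = "Matrix.vec k (\<lambda>c. z (pick T c))"
  define B where "B = {i. i < n \<and> i \<notin> T \<and> z i = 1}"
  let ?w = "Matrix.vec k (\<lambda>r. \<Sum>i\<in>B. W $$ (r, i))"
  obtain M where M: "mat_inverse ?A = Some M" "M \<in> carrier_mat k k" "M * ?A = 1\<^sub>m k"
    by (rule basis_inverse[OF T])
  have A: "?A \<in> carrier_mat k k" by (rule col_submat_carrier[OF T])
  have "(\<Sum>i\<in>{0..<n} - T. W $$ (r, i) * z i) = (\<Sum>i\<in>B. W $$ (r, i))" for r
    using z(2) by (intro sum.mono_neutral_cong_right) (auto simp: B_def, blast+)
  then have "b = ?A *\<^sub>v ?v + ?w" using lin_split[OF T, of z] z(1) by simp
  then have "b - ?w = ?A *\<^sub>v ?v"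
    using A b by (intro eq_vecI) auto
  then have "M *\<^sub>v (b - ?w) = (M * ?A) *\<^sub>v ?v" using M A by (subst assoc_mult_mat_vec[of _ k k]) auto
  then have Mb: "the (mat_inverse ?A) *\<^sub>v (b - ?w) = ?v" using M by simp
  obtain c where c: "c < k" "pick T c = j"
    using bij_betw_imp_surj_on[OF bij_pick[OF T]] j by (metis atLeastLessThan_iff imageE)
  have "B \<subseteq> {0..<n} - T" by (auto simp: B_def)
  then have "vec_index (the (mat_inverse ?A) *\<^sub>v (b - ?w)) c \<notin> {0, 1}"
    using gen T c(1) unfolding generic_def col_basis_def by auto
  then show ?thesis using c by (simp add: Mb)
qed

text \<open>Kernel vectors supported on a basis vanish, which makes \<open>v\<close> a vertex;
  genericity keeps every coordinate in \<open>T\<close> fractional, so \<open>S v\<close> cannot be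
  smaller than \<open>T\<close>.\<close>

lemma vertex_of_basis:
  assumes T: "col_basis T" and v: "v \<in> P" "S v \<subseteq> T"
  shows "v \<in> V" and "S v = T"
proof -
  show "v \<in> V"
  proof (rule vertexI[OF v(1)])
    fix d i assume "lin d = 0\<^sub>v k" "supp_in d (S v)" "i < n"
    then show "d i = 0" using ker_basis_zero[OF T, of d i] v(2) by (auto simp: supp_in_def)
  qed
  have out: "vec_index v i \<in> {0, 1}" if "i < n" "i \<notin> T" for i
    using not_in_S[OF v(1) that(1)] that(2) v(2) by auto
  have "lin (vec_index v) = b" using v by (simp add: in_P_iff)
  then have "vec_index v j \<notin> {0, 1}" if "j \<in> T" for j
    using generic_coordinates[OF T _ out that] by simp
  moreover have "T \<subseteq> {0..<n}" using T by (simp add: col_basis_def)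
  ultimately have "T \<subseteq> S v" using not_in_S[OF v(1)] by (meson atLeastLessThan_iff subset_iff)
  with v(2) show "S v = T" by simp
qed

text \<open>\<open>S v\<close> is independent, hence contained in a basis \<open>T\<close>, and
  genericity forces equality. In particular \<open>S v\<close> has \<open>k\<close>
  elements.\<close>

lemma basis_of_vertex:
  assumes v: "v \<in> V"
  shows "col_basis (S v)"
proof -
  obtain S0 where "col_basis S0" using basis_exists[OF full_rank] .
  then obtain T where T: "col_basis T" "S v \<subseteq> T"
    using basis_extend[of S0 "S v"] S_subset vertex_independent[OF v] by metis
  have "S v = T" using vertex_of_basis(2)[OF T(1) _ T(2)] v V_subset_P by auto
  with T show ?thesis by simp
qed

text \<open>A vertex is determined by \<open>S v\<close> and \<open>B_set n v\<close>: two vertices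
  sharing both differ by a kernel vector supported on \<open>S v\<close>.\<close>

lemma finite_V: "finite V"
proof (rule inj_on_finite)
  show "inj_on (\<lambda>v. (S v, B_set n v)) V"
  proof (rule inj_onI)
    fix v w assume vw: "v \<in> V" "w \<in> V" "(S v, B_set n v) = (S w, B_set n w)"
    then have P: "v \<in> P" "w \<in> P" using V_subset_P by auto
    let ?d = "\<lambda>i. vec_index v i - vec_index w i"
    have "?d i = 0" if i: "i < n" "i \<notin> S v" for i
    proof -
      have "vec_index v i \<in> {0, 1}" "vec_index w i \<in> {0, 1}"
        using not_in_S[OF P(1) i(1)] not_in_S[OF P(2) i(1)] i(2) vw(3) by simp_all
      moreover have "i \<in> B_set n v \<longleftrightarrow> i \<in> B_set n w" using vw(3) by simp
      ultimately show ?thesis using i(1) by (auto simp: B_set_def)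
    qed
    then have "supp_in ?d (S v)" by (auto simp: supp_in_def)
    moreover have "lin ?d = 0\<^sub>v k" using P by (intro lin_diff) (auto simp: in_P_iff)
    ultimately have "?d i = 0" if "i < n" for i using vertex_independent[OF vw(1)] that by blast
    then show "v = w" using P by (intro P_eqI) auto
  qed
  show "(\<lambda>v. (S v, B_set n v)) ` V \<subseteq> Pow {0..<n} \<times> Pow {0..<n}"
    by (auto simp: S_set_def B_set_def)
qed auto

text \<open>Among the points of the minimal face of \<open>x\<close>, one with the fewest fractional
  coordinates is a vertex: otherwise it could be moved along a kernel vector until one more
  coordinate becomes 0 or 1.\<close>

lemma vertex_in_face:
  assumes x: "x \<in> P"
  obtains v where "v \<in> V" "\<And>i. i < n \<Longrightarrow> vec_index x i \<in> {0, 1} \<Longrightarrow> vec_index v i = vec_index x i"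
proof -
  define F where "F v \<longleftrightarrow> v \<in> P \<and> (\<forall>i<n. vec_index x i \<in> {0, 1} \<longrightarrow> vec_index v i = vec_index x i)" for v
  define v where "v = arg_min (\<lambda>v. card (S v)) F"
  have "F x" using x by (simp add: F_def)
  then have v: "F v" and min: "\<And>w. F w \<Longrightarrow> card (S v) \<le> card (S w)"
    using arg_min_nat_lemma[of F x "\<lambda>v. card (S v)"] by (auto simp: v_def)
  have vP: "v \<in> P" using v by (simp add: F_def)
  have "v \<in> V"
  proof (rule vertexI[OF vP], rule ccontr)
    fix d i assume d: "lin d = 0\<^sub>v k" "supp_in d (S v)" "i < n" "d i \<noteq> 0"
    have dS: "0 < vec_index v m \<and> vec_index v m < 1" if "m < n" "d m \<noteq> 0" for m
      using that d(2) by (auto simp: supp_in_def S_set_def)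
    obtain t j where t: "t > 0" "j < n" "d j \<noteq> 0" "vec_index v j + t * d j \<in> {0, 1}"
      and c: "\<And>m. m < n \<Longrightarrow> 0 \<le> vec_index v m + t * d m \<and> vec_index v m + t * d m \<le> 1"
      using ray_exits_cube_interior[of n "vec_index v" d i] vP d(3,4) dS unfolding in_P_iff by blast
    let ?w = "Matrix.vec n (\<lambda>m. vec_index v m + t * d m)"
    have w: "?w \<in> P" using vP d(1) c by (intro vec_in_P) (auto simp: in_P_iff lin_add_ker)
    \<comment> \<open>Where \<open>x\<close> is 0 or 1, so is \<open>v\<close>; by \<open>dS\<close>
      the direction \<open>d\<close> vanishes there.\<close>
    have "F ?w" using v w dS unfolding F_def by (auto, (metis less_irrefl)+)
    have "S ?w \<subseteq> S v"
    proof
      fix m assume m: "m \<in> S ?w"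
      show "m \<in> S v"
      proof (cases "d m = 0")
        case False with m dS[of m] show ?thesis by (auto simp: S_set_def)
      qed (use m in \<open>auto simp: S_set_def\<close>)
    qed
    moreover have "j \<in> S v" "j \<notin> S ?w" using dS t by (auto simp: S_set_def)
    ultimately have "S ?w \<subset> S v" by blast
    then have "card (S ?w) < card (S v)" by (intro psubset_card_mono) (auto simp: S_set_def)
    with min[OF \<open>F ?w\<close>] show False by simp
  qed
  then show thesis using v by (intro that[of v]) (auto simp: F_def)
qed

end

section \<open>Cancellation along the edges\<close>

context generic_section
begin

text \<open>A flag is a vertex together with the coordinate that is released along one of its edges.\<close>

definition flags :: "(real Matrix.vec \<times> nat) set" where
  "flags = (SIGMA v:V. {0..<n} - S v)"

text \<open>The coordinates that may vary along the edge of the flag.\<close>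

definition free :: "real Matrix.vec \<times> nat \<Rightarrow> nat set" where
  "free e = insert (snd e) (S (fst e))"

text \<open>An edge is recorded by its free coordinates and the fixed values of the others; opposite
  flags sit at the two ends of one edge.\<close>

definition opposite :: "real Matrix.vec \<times> nat \<Rightarrow> real Matrix.vec \<times> nat \<Rightarrow> bool" where
  "opposite e e' \<longleftrightarrow> fst e \<noteq> fst e' \<and> free e = free e'
     \<and> (\<forall>m<n. m \<notin> free e \<longrightarrow> vec_index (fst e) m = vec_index (fst e') m)"

lemma opposite_sym: "opposite e e' \<Longrightarrow> opposite e' e"
  by (auto simp: opposite_def)

lemma flagsD:
  assumes "(v, i) \<in> flags"
  shows "v \<in> V" "v \<in> P" "i < n" "i \<notin> S v" "col_basis (S v)" "vec_index v i \<in> {0, 1}"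
    "D (S v) > 0"
proof -
  show v: "v \<in> V" "v \<in> P" "i < n" "i \<notin> S v" using assms V_subset_P by (auto simp: flags_def)
  show B: "col_basis (S v)" using basis_of_vertex v by blast
  show "vec_index v i \<in> {0, 1}" using not_in_S v by blast
  show "D (S v) > 0" using B by (simp add: col_basis_def)
qed

text \<open>Releasing \<open>i\<close>, one follows the circuit in \<open>insert i (S v)\<close>
  until a first coordinate \<open>j\<close> reaches a facet. The other free coordinates form a basis
  again, so the end point is a vertex whose flag along \<open>j\<close> leads back.\<close>

lemma opposite_exists:
  assumes e: "(v, i) \<in> flags"
  shows "\<exists>e'\<in>flags. opposite (v, i) e'"
proof -
  note v = flagsD[OF e]
  \<comment> \<open>The entry \<open>1 - 2 * v_i\<close> is 1 at \<open>v_i = 0\<close> and -1 at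
    \<open>v_i = 1\<close>, so \<open>d\<close> points into the cube at \<open>i\<close>.\<close>
  obtain d where d: "lin d = 0\<^sub>v k" "supp_in d (insert i (S v))" "d i = 1 - 2 * vec_index v i"
    using circuit_exists[OF v(5,3,4)] .
  have di: "d i \<noteq> 0" using d(3) v(6) by auto
  have vS: "0 < vec_index v m \<and> vec_index v m < 1 \<or> m = i" if "m < n" "d m \<noteq> 0" for m
    using that d(2) by (auto simp: supp_in_def S_set_def)
  obtain t j where t: "t > 0" "j < n" "d j \<noteq> 0" "vec_index v j + t * d j \<in> {0, 1}"
    and c: "\<And>m. m < n \<Longrightarrow> 0 \<le> vec_index v m + t * d m \<and> vec_index v m + t * d m \<le> 1"
  proof (rule ray_exits_cube[of n "vec_index v" d])
    show "0 \<le> vec_index v m \<and> vec_index v m \<le> 1" if "m < n" for m using v(2) that by (simp add: in_P_iff)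
    show "vec_index v m < 1" if "m < n" "d m > 0" for m using vS[of m] that d(3) v(6) by auto
    show "vec_index v m > 0" if "m < n" "d m < 0" for m using vS[of m] that d(3) v(6) by auto
    show "\<exists>m<n. d m \<noteq> 0" using di v(3) by blast
  qed blast
  let ?w = "Matrix.vec n (\<lambda>m. vec_index v m + t * d m)"
  have w: "?w \<in> P" using v(2) d(1) c by (intro vec_in_P) (auto simp: in_P_iff lin_add_ker)
  define T where "T = insert i (S v) - {j}"
  have j: "j \<in> insert i (S v)" using t d(2) by (auto simp: supp_in_def)
  have T: "col_basis T"
  \<comment> \<open>If \<open>i\<close> itself stops the ray, the edge runs between opposite facets
    and both ends share one basis; otherwise \<open>j\<close> is exchanged for
    \<open>i\<close>.\<close>
  proof (cases "j = i")
    case True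
    then show ?thesis using v(4,5) by (simp add: T_def)
  next
    case False
    then have "T = insert i (S v - {j})" "j \<in> S v" using j by (auto simp: T_def)
    then show ?thesis using basis_exchange[OF v(5,3,4) d(1,2) di _ t(3)] by simp
  qed
  have out: "vec_index ?w m = vec_index v m" if "m < n" "m \<notin> insert i (S v)" for m
    using that d(2) by (auto simp: supp_in_def)
  have "S ?w \<subseteq> T"
  proof
    fix m assume m: "m \<in> S ?w"
    then have "m < n" by (simp add: S_set_def)
    moreover have "m \<noteq> j" using m t by (auto simp: S_set_def)
    moreover have "m \<in> insert i (S v)"
    proof (rule ccontr)
      assume no: "m \<notin> insert i (S v)"
      then have "vec_index v m \<in> {0, 1}" using not_in_S[OF v(2) \<open>m < n\<close>] by simp
      with m out[OF \<open>m < n\<close> no] show False by (auto simp: S_set_def)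
    qed
    ultimately show "m \<in> T" by (simp add: T_def)
  qed
  from vertex_of_basis[OF T w this] have wV: "?w \<in> V" "S ?w = T" .
  then have "(?w, j) \<in> flags" using t by (simp add: flags_def T_def)
  moreover have "vec_index ?w i \<noteq> vec_index v i" using v(3) t(1) di by simp
  then have "?w \<noteq> v" by metis
  then have "opposite (v, i) (?w, j)"
    using out wV(2) j by (auto simp: opposite_def free_def T_def simp del: index_vec)
  ultimately show ?thesis by blast
qed

text \<open>The entry at \<open>i\<close> cannot vanish, since the difference would then be
  supported on the independent set \<open>S v\<close> and the two ends would coincide.\<close>

lemma edge_direction:
  assumes e: "(v, i) \<in> flags" and o: "opposite (v, i) (w, j)" "(w, j) \<in> flags"
  defines "d \<equiv> \<lambda>m. vec_index w m - vec_index v m"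
  shows "lin d = 0\<^sub>v k" "supp_in d (insert i (S v))" "d i \<noteq> 0"
proof -
  note v = flagsD[OF e] and w = flagsD[OF o(2)]
  show d: "lin d = 0\<^sub>v k" unfolding d_def using v(2) w(2) by (intro lin_diff) (simp add: in_P_iff)
  show s: "supp_in d (insert i (S v))"
    using o by (auto simp: opposite_def free_def supp_in_def d_def)
  show "d i \<noteq> 0"
  proof
    assume "d i = 0"
    with s have "supp_in d (S v)" by (auto simp: supp_in_def)
    then have "vec_index v m = vec_index w m" if "m < n" for m
      using vertex_independent[OF v(1) d _ that] by (simp add: d_def)
    then have "v = w" using v(2) w(2) by (intro P_eqI)
    with o show False by (simp add: opposite_def)
  qed
qed

text \<open>Kernel vectors supported on \<open>insert i T\<close> are determined by their entry at
  \<open>i\<close>, because \<open>d - c e\<close> is supported on the basis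
  \<open>T\<close>.\<close>

lemma circuit_unique:
  assumes v: "col_basis T" "i \<notin> T"
    and d: "lin d = 0\<^sub>v k" "supp_in d (insert i T)" and e: "lin e = 0\<^sub>v k" "supp_in e (insert i T)"
    and "d i = c * e i" and m: "m < n"
  shows "d m = c * e m"
proof -
  have "lin (\<lambda>m. d m - c * e m) = 0\<^sub>v k" using d e by (intro ker_diff ker_scale)
  moreover have "d j - c * e j = 0" if "j < n" "j \<notin> T" for j
    using assms that by (cases "j = i") (auto simp: supp_in_def)
  then have "supp_in (\<lambda>m. d m - c * e m) T" by (simp add: supp_in_def)
  ultimately show ?thesis using ker_basis_zero[OF v(1) _ _ m] by force
qed

text \<open>Both displacements from \<open>v\<close> lie on one line, so the nearer end would be
  strictly between \<open>v\<close> and the farther one.\<close>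

lemma opposite_not_nested:
  assumes e: "(v, i) \<in> flags" and o: "opposite (v, i) (w, j)" "(w, j) \<in> flags"
    "opposite (v, i) (u, l)" "(u, l) \<in> flags"
    and less: "\<bar>vec_index w i - vec_index v i\<bar> < \<bar>vec_index u i - vec_index v i\<bar>"
  shows False
proof -
  note v = flagsD[OF e] and w = flagsD[OF o(2)] and u = flagsD[OF o(4)]
  let ?d = "\<lambda>m. vec_index w m - vec_index v m" and ?e = "\<lambda>m. vec_index u m - vec_index v m"
  note d = edge_direction[OF e o(1,2)] and e' = edge_direction[OF e o(3,4)]
  define c where "c = ?d i / ?e i"
  have "?d i = c * ?e i" using e' by (simp add: c_def)
  then have dm: "?d m = c * ?e m" if "m < n" for m
    using circuit_unique[OF v(5,4) d(1,2) e'(1,2) _ that] by simp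
  have "0 \<le> vec_index w i" "vec_index w i \<le> 1" "0 \<le> vec_index u i" "vec_index u i \<le> 1"
    using w(2) u(2) v(3) by (auto simp: in_P_iff)
  \<comment> \<open>As \<open>v_i\<close> is 0 or 1, both displacements at \<open>i\<close> point
    into the cube and have the same sign; the hypothesis on moduli then bounds the ratio.\<close>
  then have c: "0 < c" "c < 1"
    using v(6) d(3) e'(3) less by (auto simp: c_def zero_less_divide_iff divide_less_eq)
  have vu: "u \<noteq> v" using o(3) by (auto simp: opposite_def)
  show False
  proof (rule vertex_not_between[OF w(1) u(2) v(2) vu c])
    fix m assume "m < n"
    from dm[OF this] show "vec_index w m = c * vec_index u m + (1 - c) * vec_index v m"
      by (simp add: algebra_simps)
  qed
qed

text \<open>Uniqueness is what makes passing to the opposite flag an involution. Two candidates are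
  equally far by \<open>opposite_not_nested\<close> and lie on the same side of
  \<open>v\<close>.\<close>

lemma opposite_unique:
  assumes e: "e \<in> flags" and o: "opposite e e'" "e' \<in> flags" "opposite e e''" "e'' \<in> flags"
  shows "e' = e''"
proof -
  obtain v i w j u l where eq: "e = (v, i)" "e' = (w, j)" "e'' = (u, l)"
    by (metis surj_pair)
  note e = e[unfolded eq] and o = o[unfolded eq]
  note v = flagsD[OF e] and w = flagsD[OF o(2)] and u = flagsD[OF o(4)]
  let ?d = "\<lambda>m. vec_index w m - vec_index v m" and ?e = "\<lambda>m. vec_index u m - vec_index v m"
  note d = edge_direction[OF e o(1,2)] and e' = edge_direction[OF e o(3,4)]
  have "\<bar>?d i\<bar> = \<bar>?e i\<bar>"
    using opposite_not_nested[OF e o] opposite_not_nested[OF e o(3,4,1,2)] by (metis linorder_less_linear)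
  moreover have "0 \<le> vec_index w i" "vec_index w i \<le> 1" "0 \<le> vec_index u i" "vec_index u i \<le> 1"
    using w(2) u(2) v(3) by (auto simp: in_P_iff)
  ultimately have di: "?d i = 1 * ?e i" using v(6) by auto
  have "?d m = 1 * ?e m" if "m < n" for m
    by (rule circuit_unique[OF v(5,4) d(1,2) e'(1,2) di that])
  then have wu: "w = u" using w(2) u(2) by (intro P_eqI) auto
  \<comment> \<open>The released coordinate is the only free one outside \<open>S w\<close>.\<close>
  have "insert j (S w) = insert l (S w)" using o wu by (simp add: opposite_def free_def)
  then have "j = l" using w(4) u(4) wu by blast
  with wu eq show ?thesis by simp
qed

section \<open>Edge vectors and their reversal\<close>

definition edge_vec :: "real Matrix.vec \<times> nat \<Rightarrow> nat \<Rightarrow> real" where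
  "edge_vec e = (SOME d. lin d = 0\<^sub>v k \<and> supp_in d (free e)
     \<and> d (snd e) = (2 * vec_index (fst e) (snd e) - 1) * D (S (fst e)))"

text \<open>The sign \<open>2 * v_i - 1\<close> makes the vector point out of the cube at
  \<open>i\<close>; the modulus \<open>D (S v)\<close> is the normalisation that
  \<open>circuit_cramer\<close> transports to the other end.\<close>

lemma edge_vec:
  assumes e: "(v, i) \<in> flags"
  shows "lin (edge_vec (v, i)) = 0\<^sub>v k" "supp_in (edge_vec (v, i)) (insert i (S v))"
    "edge_vec (v, i) i = (2 * vec_index v i - 1) * D (S v)"
proof -
  note v = flagsD[OF e]
  obtain d where d: "lin d = 0\<^sub>v k" "supp_in d (insert i (S v))" "d i = (2 * vec_index v i - 1) * D (S v)"
    using circuit_exists[OF v(5,3,4)] .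
  have "\<exists>d. lin d = 0\<^sub>v k \<and> supp_in d (free (v, i))
     \<and> d (snd (v, i)) = (2 * vec_index (fst (v, i)) (snd (v, i)) - 1) * D (S (fst (v, i)))"
    using d by (auto simp: free_def)
  from someI_ex[OF this] show "lin (edge_vec (v, i)) = 0\<^sub>v k" "supp_in (edge_vec (v, i)) (insert i (S v))"
    "edge_vec (v, i) i = (2 * vec_index v i - 1) * D (S v)"
    by (simp_all add: edge_vec_def free_def)
qed

text \<open>\<open>circuit_unique\<close> reduces the claim to the entry at \<open>j\<close>, where
  modulus and sign are compared separately.\<close>

lemma edge_vec_opposite:
  assumes e: "(v, i) \<in> flags" and o: "opposite (v, i) (w, j)" "(w, j) \<in> flags" and m: "m < n"
  shows "edge_vec (w, j) m = - edge_vec (v, i) m"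
proof -
  note v = flagsD[OF e] and w = flagsD[OF o(2)]
  note \<delta> = edge_vec[OF e] and \<delta>' = edge_vec[OF o(2)]
  let ?\<delta> = "edge_vec (v, i)"
  have free: "insert i (S v) = insert j (S w)" using o by (simp add: opposite_def free_def)
  let ?d = "\<lambda>m. vec_index w m - vec_index v m"
  note d = edge_direction[OF e o]
  define a where "a = ?d i / ?\<delta> i"
  have \<delta>i: "?\<delta> i \<noteq> 0" "\<bar>?\<delta> i\<bar> = D (S v)" using \<delta>(3) v(6,7) by (auto simp: abs_mult)
  then have "?d i = a * ?\<delta> i" by (simp add: a_def)
  then have dm: "?d m = a * ?\<delta> m" if "m < n" for m
    using circuit_unique[OF v(5,4) d(1,2) \<delta>(1,2) _ that] by simp
  have "0 \<le> vec_index w i" "vec_index w i \<le> 1" using w(2) v(3) by (auto simp: in_P_iff)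
  \<comment> \<open>At \<open>i\<close> the displacement from \<open>v\<close> to \<open>w\<close>
    points into the cube, the edge vector out of it.\<close>
  then have a: "a < 0"
    using v(6,7) d(3) \<delta>(3) by (auto simp: a_def divide_less_0_iff)
  have abs: "\<bar>?\<delta> j\<bar> = D (S w)"
  proof (cases "j = i")
    case True
    then have "S v = S w" using free v(4) w(4) by (metis Diff_insert_absorb)
    then show ?thesis using True \<delta>i by simp
  next
    case False
    then have j: "j \<in> S v" using free by (metis insertE insertI1)
    have "S w = insert i (S v) - {j}" using free w(4) by (metis Diff_insert_absorb)
    then have "S w = insert i (S v - {j})" using False by (simp add: insert_Diff_if)
    with j have "\<bar>?\<delta> j\<bar> * D (S v) = D (S v) * D (S w)"
      using circuit_cramer[OF v(5,3,4) \<delta>(1,2), of j] \<delta>i by simp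
    then show ?thesis using v(7) by simp
  qed
  have vj: "0 \<le> vec_index v j" "vec_index v j \<le> 1" using v(2) w(3) by (auto simp: in_P_iff)
  \<comment> \<open>At \<open>j\<close> the displacement from \<open>v\<close> heads for the facet
    that contains \<open>w\<close>; \<open>a < 0\<close> turns this into the sign of
    \<open>?\<delta> j\<close>.\<close>
  have "?\<delta> j = - ((2 * vec_index w j - 1) * D (S w))"
  proof (cases "vec_index w j = 1")
    case True
    then have "a * ?\<delta> j \<ge> 0" using dm[OF w(3)] vj by simp
    then have "?\<delta> j \<le> 0" using a by (simp add: zero_le_mult_iff)
    then show ?thesis using True abs by simp
  next
    case False
    then have w0: "vec_index w j = 0" using w(6) by simp
    then have "a * ?\<delta> j \<le> 0" using dm[OF w(3)] vj by simp
    then have "?\<delta> j \<ge> 0" using a by (simp add: mult_le_0_iff)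
    then show ?thesis using w0 abs by simp
  qed
  then have j: "edge_vec (w, j) j = - 1 * ?\<delta> j" using \<delta>'(3) by simp
  have "supp_in ?\<delta> (insert j (S w))" using \<delta>(2) free by simp
  then have "edge_vec (w, j) m = - 1 * ?\<delta> m"
    by (rule circuit_unique[OF w(5,4) \<delta>'(1,2) \<delta>(1) _ j m])
  then show ?thesis by simp
qed

section \<open>Vertex weights and edge weights\<close>

definition factor :: "real Matrix.vec \<Rightarrow> nat set \<Rightarrow> real Matrix.vec \<Rightarrow> nat \<Rightarrow> real" where
  "factor x T v m = (if m \<in> T then vec_index x m * (1 - vec_index x m)
     else if vec_index v m = 0 then 1 - vec_index x m else vec_index x m)"

definition weight :: "real Matrix.vec \<Rightarrow> real Matrix.vec \<Rightarrow> real" where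
  "weight x v = D (S v) * (\<Prod>m<n. factor x (S v) v m)"

text \<open>This is the monomial \<open>Q(x)\<close>; the determinant sits in
  \<open>edge_vec\<close> instead. The separate argument \<open>T\<close> of \<open>factor\<close>
  serves both \<open>P_v\<close>, with \<open>T = S v\<close>, and \<open>Q\<close>, with
  \<open>T = free e\<close>.\<close>

definition edge_weight :: "real Matrix.vec \<Rightarrow> real Matrix.vec \<times> nat \<Rightarrow> real" where
  "edge_weight x e = (\<Prod>m<n. factor x (free e) (fst e) m)"

lemma edge_weight_opposite: "opposite e e' \<Longrightarrow> edge_weight x e' = edge_weight x e"
  unfolding edge_weight_def by (intro prod.cong) (auto simp: opposite_def factor_def)

text \<open>Only the factor at \<open>i\<close> differs: multiplying it by \<open>v_i - x_i\<close>
  gives \<open>x_i (1 - x_i)\<close> for \<open>v_i = 1\<close> and \<open>- x_i (1 - x_i)\<close>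
  for \<open>v_i = 0\<close>.\<close>

lemma weight_edge_weight:
  assumes e: "(v, i) \<in> flags"
  shows "weight x v * (vec_index v i - vec_index x i) = edge_weight x (v, i) * edge_vec (v, i) i"
proof -
  note v = flagsD[OF e]
  define r where "r = (\<Prod>m\<in>{..<n} - {i}. factor x (S v) v m)"
  have w: "weight x v = D (S v) * (factor x (S v) v i * r)"
    unfolding weight_def r_def using v(3) by (subst prod.remove[of _ i]) auto
  have "edge_weight x (v, i) = factor x (insert i (S v)) v i * (\<Prod>m\<in>{..<n} - {i}. factor x (insert i (S v)) v m)"
    unfolding edge_weight_def free_def using v(3) by (subst prod.remove[of _ i]) auto
  also have "(\<Prod>m\<in>{..<n} - {i}. factor x (insert i (S v)) v m) = r"
    unfolding r_def by (intro prod.cong) (auto simp: factor_def)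
  finally have Q: "edge_weight x (v, i) = vec_index x i * (1 - vec_index x i) * r"
    by (simp add: factor_def)
  show ?thesis
    unfolding w Q edge_vec(3)[OF e] using v(4,6) by (auto simp: factor_def algebra_simps)
qed

lemma weight_decomposition:
  assumes x: "x \<in> P" and v: "v \<in> V" and m: "m < n"
  shows "weight x v * (vec_index v m - vec_index x m)
    = (\<Sum>i\<in>{0..<n} - S v. edge_weight x (v, i) * edge_vec (v, i) m)"
proof -
  let ?l = "\<lambda>m. weight x v * (vec_index v m - vec_index x m)"
  let ?r = "\<lambda>m. \<Sum>i\<in>{0..<n} - S v. edge_weight x (v, i) * edge_vec (v, i) m"
  have vP: "v \<in> P" using v V_subset_P by auto
  have fl: "(v, i) \<in> flags" if "i \<in> {0..<n} - S v" for i using that v by (simp add: flags_def)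
  have "lin ?l = 0\<^sub>v k" using vP x by (intro ker_scale lin_diff) (simp add: in_P_iff)
  moreover have "lin ?r = 0\<^sub>v k" using fl by (intro ker_sum ker_scale edge_vec)
  ultimately have "lin (\<lambda>m. ?l m - ?r m) = 0\<^sub>v k" by (rule ker_diff)
  moreover have "?l j = ?r j" if j: "j < n" "j \<notin> S v" for j
  proof -
    \<comment> \<open>Outside \<open>S v\<close> only the summand \<open>i = j\<close> survives,
      since the other edge vectors at \<open>v\<close> vanish at \<open>j\<close>.\<close>
    have "?r j = (\<Sum>i\<in>{j}. edge_weight x (v, i) * edge_vec (v, i) j)"
      using j edge_vec(2)[OF fl] by (intro sum.mono_neutral_right) (auto simp: supp_in_def)
    then show ?thesis using weight_edge_weight[OF fl, of j] j by simp
  qed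
  then have "supp_in (\<lambda>m. ?l m - ?r m) (S v)" by (simp add: supp_in_def)
  ultimately show ?thesis using vertex_independent[OF v _ _ m] by force
qed

text \<open>Reindexing by the involution \<open>\<phi>\<close> flips the sign of every term, so the
  sum equals its own negative.\<close>

lemma sum_flags_zero:
  assumes m: "m < n"
  shows "(\<Sum>e\<in>flags. edge_weight x e * edge_vec e m) = 0"
proof -
  define \<phi> where "\<phi> e = (SOME e'. e' \<in> flags \<and> opposite e e')" for e
  have \<phi>: "\<phi> e \<in> flags" "opposite e (\<phi> e)" if "e \<in> flags" for e
  proof -
    have "\<exists>e'. e' \<in> flags \<and> opposite e e'" using opposite_exists that by (cases e) blast
    from someI_ex[OF this] show "\<phi> e \<in> flags" "opposite e (\<phi> e)" by (simp_all add: \<phi>_def)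
  qed
  have inv: "\<phi> (\<phi> e) = e" if "e \<in> flags" for e
    using opposite_unique[of "\<phi> e" "\<phi> (\<phi> e)" e] \<phi> opposite_sym that by blast
  let ?f = "\<lambda>e. edge_weight x e * edge_vec e m"
  have neg: "?f (\<phi> e) = - ?f e" if "e \<in> flags" for e
    using edge_vec_opposite[of "fst e" "snd e" "fst (\<phi> e)" "snd (\<phi> e)" m]
      edge_weight_opposite[of e "\<phi> e" x] \<phi>[OF that] that m by simp
  have "sum ?f flags = (\<Sum>e\<in>flags. ?f (\<phi> e))"
    by (rule sum.reindex_bij_witness[of _ \<phi> \<phi>]) (simp_all add: \<phi> inv)
  also have "\<dots> = - sum ?f flags" by (simp add: neg sum_negf)
  finally show ?thesis by simp
qed

section \<open>The weighted mean of the vertices and positivity of the total weight\<close>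

lemma sum_weight_vertices:
  assumes x: "x \<in> P" and m: "m < n"
  shows "(\<Sum>v\<in>V. weight x v * vec_index v m) = (\<Sum>v\<in>V. weight x v) * vec_index x m"
proof -
  have "(\<Sum>v\<in>V. weight x v * (vec_index v m - vec_index x m))
      = (\<Sum>v\<in>V. \<Sum>i\<in>{0..<n} - S v. edge_weight x (v, i) * edge_vec (v, i) m)"
    using weight_decomposition[OF x _ m] by simp
  also have "\<dots> = (\<Sum>e\<in>flags. edge_weight x e * edge_vec e m)"
    unfolding flags_def by (subst sum.Sigma) (auto simp: finite_V)
  also have "\<dots> = 0" by (rule sum_flags_zero[OF m])
  finally show ?thesis by (simp add: right_diff_distrib sum_subtractf sum_distrib_right)
qed

lemma weight_nonneg:
  assumes x: "x \<in> P"
  shows "weight x v \<ge> 0"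
  unfolding weight_def using x by (intro mult_nonneg_nonneg prod_nonneg) (auto simp: factor_def in_P_iff)

lemma weight_sum_pos:
  assumes x: "x \<in> P"
  shows "(\<Sum>v\<in>V. weight x v) > 0"
proof -
  obtain v where v: "v \<in> V" and f: "\<And>i. i < n \<Longrightarrow> vec_index x i \<in> {0, 1} \<Longrightarrow> vec_index v i = vec_index x i"
    using vertex_in_face[OF x] by blast
  have vP: "v \<in> P" using v V_subset_P by auto
  have "factor x (S v) v m > 0" if m: "m < n" for m
  proof -
    have b: "0 \<le> vec_index x m" "vec_index x m \<le> 1" using x m by (auto simp: in_P_iff)
    show ?thesis
    \<comment> \<open>Where \<open>x\<close> is 0 or 1, \<open>v\<close> has the same value and the
      factor is 1; where \<open>x\<close> is fractional, every form of the factor is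
      positive.\<close>
    proof (cases "vec_index x m \<in> {0, 1}")
      case True
      moreover from f[OF m True] True have "m \<notin> S v" by (auto simp: S_set_def)
      ultimately show ?thesis using f[OF m] by (auto simp: factor_def)
    next
      case False
      with b have "0 < vec_index x m" "vec_index x m < 1" by auto
      then show ?thesis by (simp add: factor_def)
    qed
  qed
  moreover have "D (S v) > 0" using basis_of_vertex[OF v] by (simp add: col_basis_def)
  ultimately have "weight x v > 0" unfolding weight_def by (intro mult_pos_pos prod_pos) auto
  then show ?thesis using v weight_nonneg[OF x] finite_V by (intro sum_pos2[of _ v]) auto
qed

lemma pmf_race_round_P_poly:
  assumes x: "x \<in> P" and C: "C \<ge> 1" "\<forall>v\<in>V. bpoly_coef_sum (P_poly W n v) \<le> C" and v: "v \<in> V"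
  shows "pmf (race_round n x V (P_poly W n) C) (Some v) = weight x v / (C * real (card V))"
proof -
  have vP: "v \<in> P" using v V_subset_P by auto
  have "(\<Prod>i<n. (vec_index x i) ^ (if i \<in> B_set n v \<union> S v then 1 else 0)
      * (1 - vec_index x i) ^ (if i \<in> A_set n v \<union> S v then 1 else 0)) = (\<Prod>i<n. factor x (S v) v i)"
    using not_in_S[OF vP] by (intro prod.cong) (auto simp: factor_def A_set_def B_set_def)
  \<comment> \<open>\<open>P_poly\<close> has one term, so its coefficient sum is
    \<open>D (S v)\<close>.\<close>
  moreover have "D (S v) \<le> C" using C(2) v by (simp add: P_poly_def bpoly_coef_sum_def)
  moreover have "0 \<le> vec_index x i \<and> vec_index x i \<le> 1" if "i < n" for i
    using x that by (simp add: in_P_iff)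
  ultimately show ?thesis
    using pmf_race_round[where P = "P_poly W n", OF finite_V v P_poly_def _ _ C(1)]
    by (simp add: weight_def)
qed

end

section \<open>Termination and mean of the race\<close>

theorem theorem5p1:
  fixes k n :: nat and W :: "real mat" and b :: "real Matrix.vec" and C :: real and x :: "real Matrix.vec"
  assumes "W \<in> carrier_mat k n"
    and "vec_space.rank k W = k"
    and "b \<in> carrier_vec k"
    and "generic k n W b"
    and "C \<ge> 1"
    and "\<forall>v\<in>vertices n W b. bpoly_coef_sum (P_poly W n v) \<le> C"
    and "x \<in> polytope n W b"
  shows "measure (race_space n x (vertices n W b) (P_poly W n) C)
             {\<omega> \<in> space (race_space n x (vertices n W b) (P_poly W n) C). race_output \<omega> = None} = 0
       \<and> (\<forall>i<n. (\<Sum>v\<in>vertices n W b.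
             measure (race_space n x (vertices n W b) (P_poly W n) C)
               {\<omega> \<in> space (race_space n x (vertices n W b) (P_poly W n) C). race_output \<omega> = Some v}
             * v $ i) = x $ i)"
proof -
  interpret generic_section k n W b
    using assms by unfold_locales
  let ?V = "vertices n W b"
  let ?R = "race_round n x ?V (P_poly W n) C"
  define s where "s = (\<Sum>v\<in>?V. weight x v)"
  define c where "c = C * real (card ?V)"
  have s: "s > 0" unfolding s_def by (rule weight_sum_pos[OF assms(7)])
  then have "?V \<noteq> {}" by (auto simp: s_def)
  then have c: "c > 0" using assms(5) finite_V by (simp add: c_def card_gt_0_iff)
  note p = pmf_race_round_P_poly[OF assms(7,5,6), folded c_def]
  \<comment> \<open>A round succeeds with probability \<open>s / c\<close>; dividing by it removes
    \<open>c\<close>, so the output law depends only on the weights.\<close>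
  have None: "pmf ?R None = 1 - s / c"
    using pmf_race_round_None[OF finite_V \<open>?V \<noteq> {}\<close>] by (simp add: p s_def sum_divide_distrib)
  then have less: "pmf ?R None < 1" using s c by simp
  note q = measure_race_output[OF less, folded race_space_def]
  have "measure (race_space n x ?V (P_poly W n) C)
      {\<omega> \<in> space (race_space n x ?V (P_poly W n) C). race_output \<omega> = Some v} = weight x v / s"
    if "v \<in> ?V" for v
    using c s by (simp add: q(2) None p[OF that])
  then have "(\<Sum>v\<in>?V. measure (race_space n x ?V (P_poly W n) C)
      {\<omega> \<in> space (race_space n x ?V (P_poly W n) C). race_output \<omega> = Some v} * vec_index v i)
      = (\<Sum>v\<in>?V. weight x v * vec_index v i) / s" for i
    by (simp add: sum_divide_distrib)
  then show ?thesis
    using q(1) sum_weight_vertices[OF assms(7), folded s_def] s by simp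
qed

end
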